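(* Let $\mathsf{M}$ be the product space of the matrix metric spaces $(\mathsf{M}_1,d_1)$ and $(\mathsf{M}_2,d_2)$. Assume the metric $d$ of $\mathsf{M}$ is majorized by some product metric $d_\psi$, and consider a product approximation operator $\mathcal{S}(\mathbf{A})=\mathcal{S}_1(\mathbf{A}_1)\mathcal{S}_2(\mathbf{A}_2)$, with $\mathcal{S}_1$ and $\mathcal{S}_2$ having approximation orders $\nu_1$ and $\nu_2$, with constants $C_1$ and $C_2$, respectively. Then $\mathcal{S}$ has approximation order $\nu=\min\{\nu_1,\nu_2\}$ with a constant $C=\max\{C_1,C_2\}\,\psi(1,1)$.
   Context: Product space: $\mathsf{M},\mathsf{M}_1,\mathsf{M}_2$ are matrix classes such that every $A\in\mathsf{M}$ has a unique decomposition $A=A_1A_2$ with $A_1\in\mathsf{M}_1$, $A_2\in\mathsf{M}_2$. The metrics of $\mathsf{M}_1$, $\mathsf{M}_2$ are $d_1$, $d_2$. Product metric: $d_\psi(A,B)=\psi(d_1(A_1,B_1),d_2(A_2,B_2))$ for $A=A_1A_2$, $B=B_1B_2$ in $\mathsf{M}$, where $\psi\colon\mathbb{R}_+\times\mathbb{R}_+\to\mathbb{R}_+$ is a continuous function that satisfies: $\psi\ge 0$, and $\psi(x_1,x_2)=0$ if and only if $x_1=x_2=0$; $\psi$ is monotone in every variable; $\psi$ is Jensen-convex, i.e. $\psi(\frac12 x+\frac12 y)\le\frac12(\psi(x)+\psi(y))$; and $\psi$ is homogeneous, i.e. $\psi(\alpha x_1,\alpha x_2)=\alpha\psi(x_1,x_2)$.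 Majorization: a metric $\bar d$ is majorized by a metric $d'$ on the same space $V$ if there is a positive constant $K$ such that $\bar d(u,v)\le K d'(u,v)$ for all $u,v\in V$. Operators: let $\mathtt{I}\subset\mathbb{R}$ be a compact interval. An approximation operator on a matrix class maps a sequence of samples $\mathbf{A}=\{A^{(i)}\}_{i\in\mathcal{J}}$, $\mathcal{J}\subset\mathbb{Z}$, from the class, taken at points $t_i<t_{i+1}$ of $\mathtt{I}$, to a function from $\mathtt{I}$ to the class. Here $\mathcal{S}_j$ is an approximation operator on $\mathsf{M}_j$, $j=1,2$. For $\mathbf{A}$ in $\mathsf{M}$ with $A^{(i)}=A_1^{(i)}A_2^{(i)}$, put $\mathbf{A}_j=\{A_j^{(i)}\}_{i\in\mathcal{J}}$; the product operator $\mathcal{S}$ on $\mathsf{M}$ is the pointwise matrix product $\mathcal{S}(\mathbf{A})(t)=\mathcal{S}_1(\mathbf{A}_1)(t)\,\mathcal{S}_2(\mathbf{A}_2)(t)$. Approximation order: an operator $\mathcal{S}$ on a matrix metric space $(\mathsf{M},d)$ has approximation order $\nu$ (with constant $C_F$) if the generated function $\Gamma(t)=\mathcal{S}(\mathbf{A})(t)$ satisfies $d(F(t),\Gamma(t))\le C_F h^\nu$, where $F$ is the sampled matrix-valued function, $A^{(i)}=F(t_i)$, $i\in\mathcal{J}$, $h=\max_i\{t_{i+1}-t_i\}$, and $C_F$ is a constant independent of $h$ (but usually depending on $F$ and on $(\mathsf{M},d)$). The orders $\nu_j$ and constants $C_j$ of $\mathcal{S}_j$ are with respect to $(\mathsf{M}_j,d_j)$,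 applied to the component $F_j$ of the unique decomposition $F(t)=F_1(t)F_2(t)$.
   Formalization: The constant C is proved for d_ψ when h ≤ 1; for d it becomes K·C, with K any majorization constant, and for samplings with arbitrary h it gets the extra factor max(1,|I|)^|ν1−ν2|, since the literal constant fails for d = 2d_ψ or for h > 1 with ν1 ≠ ν2. *)

theory Defs
  imports "HOL-Analysis.Analysis"
begin

text \<open>A sequence of sample points is a pair \<open>(J, \<tau>)\<close>: an index set \<open>J\<close> of consecutive integers and a
  function \<open>\<tau>\<close> with domain \<open>J\<close>. All \<open>J\<close>-indexed families are extensional (\<open>\<rightarrow>\<^sub>E\<close>), so that an operator
  sees only the values at indices in \<open>J\<close>. At least two indices are required, as otherwise there is
  no largest gap.\<close>

definition samplings :: "real set \<Rightarrow> (int set \<times> (int \<Rightarrow> real)) set" where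
  "samplings I = {(J, \<tau>). (\<forall>i\<in>J. \<forall>k\<in>J. {i..k} \<subseteq> J) \<and> (\<exists>i\<in>J. i + 1 \<in> J) \<and>
     \<tau> \<in> J \<rightarrow>\<^sub>E I \<and> (\<forall>i\<in>J. i + 1 \<in> J \<longrightarrow> \<tau> i < \<tau> (i + 1))}"

text \<open>For infinite \<open>J\<close> in a bounded interval the supremum is attained too, since the gaps are
  positive with a finite sum.\<close>

definition mesh :: "int set \<Rightarrow> (int \<Rightarrow> real) \<Rightarrow> real" where
  "mesh J \<tau> = (SUP i\<in>{i\<in>J. i + 1 \<in> J}. \<tau> (i + 1) - \<tau> i)"

text \<open>An operator takes \<open>J\<close>, the sample points, the samples, and the evaluation point. The set \<open>\<T>\<close>
  consists of the samplings it is applied to, for instance those whose points exhaust \<open>I\<close>.\<close>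

type_synonym 'm sample_op = "int set \<Rightarrow> (int \<Rightarrow> real) \<Rightarrow> (int \<Rightarrow> 'm) \<Rightarrow> real \<Rightarrow> 'm"

definition approx_operator ::
  "real set \<Rightarrow> (int set \<times> (int \<Rightarrow> real)) set \<Rightarrow> 'm set \<Rightarrow> 'm sample_op \<Rightarrow> bool" where
  "approx_operator I \<T> V S \<longleftrightarrow>
     (\<forall>(J, \<tau>)\<in>\<T>. \<forall>A \<in> J \<rightarrow>\<^sub>E V. \<forall>t\<in>I. S J \<tau> A t \<in> V)"

text \<open>\<open>F\<close> is the sampled function; \<open>C\<close> may depend on \<open>F\<close> but not on the sampling.\<close>

definition has_approx_order ::
  "('m \<Rightarrow> 'm \<Rightarrow> real) \<Rightarrow> real set \<Rightarrow> (int set \<times> (int \<Rightarrow> real)) set \<Rightarrow> 'm sample_op \<Rightarrow>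
   (real \<Rightarrow> 'm) \<Rightarrow> real \<Rightarrow> real \<Rightarrow> bool" where
  "has_approx_order d I \<T> S F \<nu> C \<longleftrightarrow>
     (\<forall>(J, \<tau>)\<in>\<T>. \<forall>t\<in>I. d (F t) (S J \<tau> (\<lambda>i\<in>J. F (\<tau> i)) t) \<le> C * mesh J \<tau> powr \<nu>)"

definition is_decomp ::
  "('a::field^'k^'m) set \<Rightarrow> ('a^'n^'k) set \<Rightarrow> 'a^'n^'m \<Rightarrow> ('a^'k^'m) \<times> ('a^'n^'k) \<Rightarrow> bool" where
  "is_decomp M1 M2 A p \<longleftrightarrow> fst p \<in> M1 \<and> snd p \<in> M2 \<and> A = fst p ** snd p"

definition unique_decomposition ::
  "('a::field^'n^'m) set \<Rightarrow> ('a^'k^'m) set \<Rightarrow> ('a^'n^'k) set \<Rightarrow> bool" where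
  "unique_decomposition M M1 M2 \<longleftrightarrow> (\<forall>A\<in>M. \<exists>!p. is_decomp M1 M2 A p)"

text \<open>The factors are meaningful only for matrices with a unique decomposition.\<close>

definition comp1 :: "('a::field^'k^'m) set \<Rightarrow> ('a^'n^'k) set \<Rightarrow> 'a^'n^'m \<Rightarrow> 'a^'k^'m" where
  "comp1 M1 M2 A = fst (THE p. is_decomp M1 M2 A p)"

definition comp2 :: "('a::field^'k^'m) set \<Rightarrow> ('a^'n^'k) set \<Rightarrow> 'a^'n^'m \<Rightarrow> 'a^'n^'k" where
  "comp2 M1 M2 A = snd (THE p. is_decomp M1 M2 A p)"

definition product_op ::
  "('a::field^'k^'m) set \<Rightarrow> ('a^'n^'k) set \<Rightarrow> ('a^'k^'m) sample_op \<Rightarrow> ('a^'n^'k) sample_op \<Rightarrow>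
   ('a^'n^'m) sample_op" where
  "product_op M1 M2 S1 S2 J \<tau> A t =
     S1 J \<tau> (\<lambda>i\<in>J. comp1 M1 M2 (A i)) t ** S2 J \<tau> (\<lambda>i\<in>J. comp2 M1 M2 (A i)) t"

text \<open>\<open>\<psi>\<close> is total in HOL; all conditions concern its restriction to the closed quadrant.\<close>

definition product_metric_fun :: "(real \<times> real \<Rightarrow> real) \<Rightarrow> bool" where
  "product_metric_fun \<psi> \<longleftrightarrow>
     continuous_on ({0..} \<times> {0..}) \<psi> \<and>
     (\<forall>x1\<ge>0. \<forall>x2\<ge>0. 0 \<le> \<psi> (x1, x2) \<and> (\<psi> (x1, x2) = 0 \<longleftrightarrow> x1 = 0 \<and> x2 = 0)) \<and>
     (\<forall>x2\<ge>0. mono_on {0..} (\<lambda>x1. \<psi> (x1, x2))) \<and>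
     (\<forall>x1\<ge>0. mono_on {0..} (\<lambda>x2. \<psi> (x1, x2))) \<and>
     (\<forall>x \<in> {0..} \<times> {0..}. \<forall>y \<in> {0..} \<times> {0..}.
        \<psi> ((1/2) *\<^sub>R x + (1/2) *\<^sub>R y) \<le> (1/2) * (\<psi> x + \<psi> y)) \<and>
     (\<forall>\<alpha>\<ge>0. \<forall>x1\<ge>0. \<forall>x2\<ge>0. \<psi> (\<alpha> * x1, \<alpha> * x2) = \<alpha> * \<psi> (x1, x2))"

definition product_dist ::
  "('a::field^'k^'m) set \<Rightarrow> ('a^'n^'k) set \<Rightarrow> ('a^'k^'m \<Rightarrow> 'a^'k^'m \<Rightarrow> real) \<Rightarrow>
   ('a^'n^'k \<Rightarrow> 'a^'n^'k \<Rightarrow> real) \<Rightarrow> (real \<times> real \<Rightarrow> real) \<Rightarrow> 'a^'n^'m \<Rightarrow> 'a^'n^'m \<Rightarrow> real" where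
  "product_dist M1 M2 d1 d2 \<psi> A B =
     \<psi> (d1 (comp1 M1 M2 A) (comp1 M1 M2 B), d2 (comp2 M1 M2 A) (comp2 M1 M2 B))"

definition majorized_with ::
  "real \<Rightarrow> 'v set \<Rightarrow> ('v \<Rightarrow> 'v \<Rightarrow> real) \<Rightarrow> ('v \<Rightarrow> 'v \<Rightarrow> real) \<Rightarrow> bool" where
  "majorized_with K V d d' \<longleftrightarrow> 0 < K \<and> (\<forall>u\<in>V. \<forall>v\<in>V. d u v \<le> K * d' u v)"

definition majorized :: "'v set \<Rightarrow> ('v \<Rightarrow> 'v \<Rightarrow> real) \<Rightarrow> ('v \<Rightarrow> 'v \<Rightarrow> real) \<Rightarrow> bool" where
  "majorized V d d' \<longleftrightarrow> (\<exists>K. majorized_with K V d d')"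

end

theory Submission
  imports Defs
begin

text \<open>
  Uniqueness of the decomposition makes the error of the product operator a function of the errors
  of its factors: the value \<open>\<Gamma>\<^sub>1(t) ** \<Gamma>\<^sub>2(t)\<close> lies in \<open>M\<close>, so its components are the generated
  factors \<open>\<Gamma>\<^sub>1(t)\<close> and \<open>\<Gamma>\<^sub>2(t)\<close> themselves, and the product distance from \<open>F(t)\<close> is \<open>\<psi>\<close> of the
  two component errors. If \<open>h\<close> is the mesh and \<open>e\<close> bounds both \<open>h powr \<nu>1\<close> and \<open>h powr \<nu>2\<close>, both
  component errors are at most \<open>c = max C1 C2 * e\<close>; monotonicity and homogeneity of \<open>\<psi>\<close> then bound
  the product error by \<open>\<psi>(c, c) = c * \<psi>(1, 1)\<close>. A metric majorized by the product metric
  only brings in the majorization constant.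

  What remains is the choice of \<open>e\<close>. For \<open>h \<le> 1\<close> the smaller exponent gives the larger power, so
  \<open>e = h powr \<nu>\<close> with \<open>\<nu> = min \<nu>1 \<nu>2\<close> will do. For larger \<open>h\<close> the other power exceeds
  \<open>h powr \<nu>\<close> by the factor \<open>h powr \<bar>\<nu>1 - \<nu>2\<bar>\<close>, which is bounded because the mesh is at most
  the length of the interval.
\<close>

section \<open>Samplings and operators on them\<close>

lemma samplings_point_mem:
  assumes "(J, \<tau>) \<in> samplings I" "i \<in> J"
  shows "\<tau> i \<in> I"
  using assms unfolding samplings_def by auto

text \<open>The supremum over the gaps is that of a nonempty set bounded by the length of the interval,
  so it lies above some gap, which is positive, and below that length.\<close>

lemma samplings_mesh_bounds:
  assumes "(J, \<tau>) \<in> samplings {a..b}"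
  shows "0 < mesh J \<tau>" "mesh J \<tau> \<le> b - a"
proof -
  let ?G = "{i \<in> J. i + 1 \<in> J}"
  from assms obtain i where i: "i \<in> ?G"
    unfolding samplings_def by auto
  have gap: "0 < \<tau> (k + 1) - \<tau> k \<and> \<tau> (k + 1) - \<tau> k \<le> b - a" if "k \<in> ?G" for k
  proof -
    have "\<tau> k \<in> {a..b}" "\<tau> (k + 1) \<in> {a..b}" "\<tau> k < \<tau> (k + 1)"
      using assms that unfolding samplings_def by (auto simp: PiE_iff)
    then show ?thesis by auto
  qed
  then have "bdd_above ((\<lambda>k. \<tau> (k + 1) - \<tau> k) ` ?G)"
    by (intro bdd_aboveI2[where M = "b - a"]) blast
  then have "\<tau> (i + 1) - \<tau> i \<le> mesh J \<tau>"
    unfolding mesh_def using i by (rule cSUP_upper2) simp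
  with gap[OF i] show "0 < mesh J \<tau>" by linarith
  show "mesh J \<tau> \<le> b - a"
    unfolding mesh_def using i gap by (intro cSUP_least) blast+
qed

lemma approx_operator_mem:
  assumes "approx_operator I \<T> V S" "(J, \<tau>) \<in> \<T>" "A \<in> J \<rightarrow>\<^sub>E V" "t \<in> I"
  shows "S J \<tau> A t \<in> V"
  using assms unfolding approx_operator_def by blast

section \<open>Decompositions and the product metric function\<close>

lemma is_decomp_components:
  assumes "unique_decomposition M M1 M2" "A \<in> M"
  shows "is_decomp M1 M2 A (comp1 M1 M2 A, comp2 M1 M2 A)"
  using theI'[of "is_decomp M1 M2 A"] assms
  unfolding unique_decomposition_def comp1_def comp2_def by simp

lemma components_matrix_mult:
  assumes "unique_decomposition M M1 M2" "A1 ** A2 \<in> M" "A1 \<in> M1" "A2 \<in> M2"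
  shows "comp1 M1 M2 (A1 ** A2) = A1" "comp2 M1 M2 (A1 ** A2) = A2"
proof -
  have "is_decomp M1 M2 (A1 ** A2) (A1, A2)"
    using assms(3,4) by (simp add: is_decomp_def)
  with is_decomp_components[OF assms(1,2)] assms(1,2)
  have "(comp1 M1 M2 (A1 ** A2), comp2 M1 M2 (A1 ** A2)) = (A1, A2)"
    unfolding unique_decomposition_def by blast
  then show "comp1 M1 M2 (A1 ** A2) = A1" "comp2 M1 M2 (A1 ** A2) = A2" by simp_all
qed

text \<open>Raise both arguments to the common bound by monotonicity, then pull it out by
  homogeneity.\<close>

lemma product_metric_fun_le:
  assumes psi: "product_metric_fun \<psi>"
    and x: "0 \<le> x1" "x1 \<le> c" "0 \<le> x2" "x2 \<le> c"
  shows "\<psi> (x1, x2) \<le> c * \<psi> (1, 1)"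
proof -
  have c: "0 \<le> c" using x by linarith
  have "mono_on {0..} (\<lambda>u. \<psi> (u, x2))" "mono_on {0..} (\<lambda>v. \<psi> (c, v))"
    using psi x c unfolding product_metric_fun_def by blast+
  then have "\<psi> (x1, x2) \<le> \<psi> (c, x2)" "\<psi> (c, x2) \<le> \<psi> (c, c)"
    using x c by (auto elim!: mono_onD)
  moreover have "\<psi> (c * 1, c * 1) = c * \<psi> (1, 1)"
    using psi c unfolding product_metric_fun_def
    by (metis zero_le_one)
  ultimately show ?thesis by simp
qed

section \<open>The error of the product operator\<close>

text \<open>The component operators are fed exactly the samples of the components of \<open>F\<close>, and uniqueness
  identifies the components of the product with their outputs.\<close>

lemma product_dist_product_op:
  assumes decomp: "unique_decomposition M M1 M2"
    and \<T>: "\<T> \<subseteq> samplings I" "(J, \<tau>) \<in> \<T>"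
    and operators: "approx_operator I \<T> M1 S1" "approx_operator I \<T> M2 S2"
      "approx_operator I \<T> M (product_op M1 M2 S1 S2)"
    and F: "F \<in> I \<rightarrow> M" and t: "t \<in> I"
  shows "product_dist M1 M2 d1 d2 \<psi> (F t) (product_op M1 M2 S1 S2 J \<tau> (\<lambda>i\<in>J. F (\<tau> i)) t) =
    \<psi> (d1 (comp1 M1 M2 (F t)) (S1 J \<tau> (\<lambda>i\<in>J. comp1 M1 M2 (F (\<tau> i))) t),
       d2 (comp2 M1 M2 (F t)) (S2 J \<tau> (\<lambda>i\<in>J. comp2 M1 M2 (F (\<tau> i))) t))"
proof -
  let ?A1 = "\<lambda>i\<in>J. comp1 M1 M2 (F (\<tau> i))" and ?A2 = "\<lambda>i\<in>J. comp2 M1 M2 (F (\<tau> i))"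
  have FM: "F (\<tau> i) \<in> M" if "i \<in> J" for i
    using samplings_point_mem[OF subsetD[OF \<T>] that] F by blast
  have "comp1 M1 M2 (F (\<tau> i)) \<in> M1 \<and> comp2 M1 M2 (F (\<tau> i)) \<in> M2" if "i \<in> J" for i
    using is_decomp_components[OF decomp FM[OF that]] by (simp add: is_decomp_def)
  then have A: "?A1 \<in> J \<rightarrow>\<^sub>E M1" "?A2 \<in> J \<rightarrow>\<^sub>E M2" "(\<lambda>i\<in>J. F (\<tau> i)) \<in> J \<rightarrow>\<^sub>E M"
    using FM by simp_all
  have mem: "S1 J \<tau> ?A1 t \<in> M1" "S2 J \<tau> ?A2 t \<in> M2"
      "product_op M1 M2 S1 S2 J \<tau> (\<lambda>i\<in>J. F (\<tau> i)) t \<in> M"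
    using operators[THEN approx_operator_mem, OF \<T>(2) _ t] A by simp_all
  have op: "product_op M1 M2 S1 S2 J \<tau> (\<lambda>i\<in>J. F (\<tau> i)) t = S1 J \<tau> ?A1 t ** S2 J \<tau> ?A2 t"
    unfolding product_op_def by (simp cong: restrict_cong)
  show ?thesis
    using components_matrix_mult[OF decomp mem(3)[unfolded op] mem(1,2)]
    by (simp add: product_dist_def op)
qed

text \<open>The two rates enter only through a common bound \<open>e\<close> of the two powers of the mesh, which
  serves both the bound on fine samplings and the one on all samplings.\<close>

lemma product_dist_product_op_le:
  assumes metric: "Metric_space M1 d1" "Metric_space M2 d2"
    and decomp: "unique_decomposition M M1 M2"
    and psi: "product_metric_fun \<psi>"
    and \<T>: "\<T> \<subseteq> samplings {a..b}" "(J, \<tau>) \<in> \<T>"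
    and operators: "approx_operator {a..b} \<T> M1 S1" "approx_operator {a..b} \<T> M2 S2"
      "approx_operator {a..b} \<T> M (product_op M1 M2 S1 S2)"
    and F: "F \<in> {a..b} \<rightarrow> M" and t: "t \<in> {a..b}"
    and order: "has_approx_order d1 {a..b} \<T> S1 (\<lambda>t. comp1 M1 M2 (F t)) \<nu>1 C1"
      "has_approx_order d2 {a..b} \<T> S2 (\<lambda>t. comp2 M1 M2 (F t)) \<nu>2 C2"
    and e: "mesh J \<tau> powr \<nu>1 \<le> e" "mesh J \<tau> powr \<nu>2 \<le> e"
  shows "product_dist M1 M2 d1 d2 \<psi> (F t) (product_op M1 M2 S1 S2 J \<tau> (\<lambda>i\<in>J. F (\<tau> i)) t)
    \<le> max C1 C2 * \<psi> (1, 1) * e"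
proof -
  let ?x1 = "d1 (comp1 M1 M2 (F t)) (S1 J \<tau> (\<lambda>i\<in>J. comp1 M1 M2 (F (\<tau> i))) t)"
  let ?x2 = "d2 (comp2 M1 M2 (F t)) (S2 J \<tau> (\<lambda>i\<in>J. comp2 M1 M2 (F (\<tau> i))) t)"
  have nonneg: "0 \<le> ?x1" "0 \<le> ?x2"
    using metric by (simp_all add: Metric_space.nonneg)
  have le: "?x1 \<le> C1 * mesh J \<tau> powr \<nu>1" "?x2 \<le> C2 * mesh J \<tau> powr \<nu>2"
    using order \<T>(2) t unfolding has_approx_order_def by fast+
  have "0 < mesh J \<tau>"
    using samplings_mesh_bounds(1) \<T> by blast
  \<comment> \<open>A nonnegative error below \<open>C1\<close> times a positive power forces \<open>C1\<close> to be nonnegative.\<close>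
  then have "0 \<le> C1"
    using order_trans[OF nonneg(1) le(1)] by (simp add: zero_le_mult_iff)
  then have "C1 * mesh J \<tau> powr \<nu>1 \<le> max C1 C2 * e" "C2 * mesh J \<tau> powr \<nu>2 \<le> max C1 C2 * e"
    using e by (auto intro!: mult_mono)
  with le have "?x1 \<le> max C1 C2 * e" "?x2 \<le> max C1 C2 * e" by linarith+
  from product_metric_fun_le[OF psi nonneg(1) this(1) nonneg(2) this(2)] show ?thesis
    using product_dist_product_op[OF decomp \<T> operators F t] by (simp add: mult_ac)
qed

section \<open>The order of the product operator\<close>

lemma has_approx_order_majorized:
  assumes "has_approx_order d' I \<T> S F \<nu> C" "majorized_with K V d d'"
    and "approx_operator I \<T> V S" "\<T> \<subseteq> samplings I" "F \<in> I \<rightarrow> V"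
  shows "has_approx_order d I \<T> S F \<nu> (K * C)"
  unfolding has_approx_order_def
proof (intro ballI, clarify)
  fix J \<tau> t assume J: "(J, \<tau>) \<in> \<T>" and t: "t \<in> I"
  let ?\<Gamma> = "S J \<tau> (\<lambda>i\<in>J. F (\<tau> i)) t"
  have "F (\<tau> i) \<in> V" if "i \<in> J" for i
    using samplings_point_mem[OF subsetD[OF assms(4) J] that] assms(5) by blast
  then have "(\<lambda>i\<in>J. F (\<tau> i)) \<in> J \<rightarrow>\<^sub>E V" by simp
  then have "F t \<in> V" "?\<Gamma> \<in> V"
    using approx_operator_mem[OF assms(3) J _ t] t assms(5) by blast+
  then have "d (F t) ?\<Gamma> \<le> K * d' (F t) ?\<Gamma>" and "0 < K"
    using assms(2) unfolding majorized_with_def by auto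
  moreover have "d' (F t) ?\<Gamma> \<le> C * mesh J \<tau> powr \<nu>"
    using assms(1) J t unfolding has_approx_order_def by fast
  ultimately show "d (F t) ?\<Gamma> \<le> K * C * mesh J \<tau> powr \<nu>"
    by (smt (verit) mult.assoc mult_left_mono)
qed

text \<open>Factor \<open>h powr \<mu> = h powr (\<mu> - \<nu>) * h powr \<nu>\<close>: the first factor has a nonnegative exponent,
  and replacing its base by \<open>max 1 L\<close> makes it increasing in the exponent as well.\<close>

lemma powr_le_max_one_powr_mult:
  fixes h L \<mu> \<nu> \<delta> :: real
  assumes "0 < h" "h \<le> L" "\<nu> \<le> \<mu>" "\<mu> - \<nu> \<le> \<delta>"
  shows "h powr \<mu> \<le> max 1 L powr \<delta> * h powr \<nu>"
proof -
  have "h powr (\<mu> - \<nu>) \<le> max 1 L powr (\<mu> - \<nu>)"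
    using assms by (intro powr_mono2) auto
  also have "\<dots> \<le> max 1 L powr \<delta>"
    using assms by (intro powr_mono) auto
  finally have "h powr (\<mu> - \<nu>) * h powr \<nu> \<le> max 1 L powr \<delta> * h powr \<nu>"
    by (rule mult_right_mono) simp
  then show ?thesis
    by (simp flip: powr_add)
qed

theorem theorem5p5:
  fixes M :: "('a::field^'n^'m) set"
    and M1 :: "('a^'k^'m) set"
    and M2 :: "('a^'n^'k) set"
    and d d\<psi> :: "'a^'n^'m \<Rightarrow> 'a^'n^'m \<Rightarrow> real"
    and d1 :: "'a^'k^'m \<Rightarrow> 'a^'k^'m \<Rightarrow> real"
    and d2 :: "'a^'n^'k \<Rightarrow> 'a^'n^'k \<Rightarrow> real"
    and \<psi> :: "real \<times> real \<Rightarrow> real"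
    and \<T> :: "(int set \<times> (int \<Rightarrow> real)) set"
    and S :: "('a^'n^'m) sample_op"
    and S1 :: "('a^'k^'m) sample_op"
    and S2 :: "('a^'n^'k) sample_op"
    and F :: "real \<Rightarrow> 'a^'n^'m"
    and a b \<nu> \<nu>1 \<nu>2 C C1 C2 :: real
  assumes metric: "Metric_space M d" "Metric_space M1 d1" "Metric_space M2 d2"
    and decomp: "unique_decomposition M M1 M2"
    and psi: "product_metric_fun \<psi>"
    and dpsi: "d\<psi> = product_dist M1 M2 d1 d2 \<psi>"
    and maj: "majorized M d d\<psi>"
    and samplings: "\<T> \<subseteq> samplings {a..b}"
    and operators: "approx_operator {a..b} \<T> M1 S1" "approx_operator {a..b} \<T> M2 S2"
      "approx_operator {a..b} \<T> M S"
    and S: "S = product_op M1 M2 S1 S2"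
    and F: "F \<in> {a..b} \<rightarrow> M"
    and order1: "has_approx_order d1 {a..b} \<T> S1 (\<lambda>t. comp1 M1 M2 (F t)) \<nu>1 C1"
    and order2: "has_approx_order d2 {a..b} \<T> S2 (\<lambda>t. comp2 M1 M2 (F t)) \<nu>2 C2"
    and \<nu>: "\<nu> = min \<nu>1 \<nu>2"
    and C: "C = max C1 C2 * \<psi> (1, 1)"
  shows "has_approx_order d\<psi> {a..b} {(J, \<tau>) \<in> \<T>. mesh J \<tau> \<le> 1} S F \<nu> C \<and>
    (\<forall>K. majorized_with K M d d\<psi> \<longrightarrow>
       has_approx_order d {a..b} {(J, \<tau>) \<in> \<T>. mesh J \<tau> \<le> 1} S F \<nu> (K * C) \<and>
       has_approx_order d {a..b} \<T> S F \<nu> (K * C * max 1 (b - a) powr \<bar>\<nu>1 - \<nu>2\<bar>))"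
proof -
  let ?fine = "{(J, \<tau>) \<in> \<T>. mesh J \<tau> \<le> 1}"
  let ?E = "max 1 (b - a) powr \<bar>\<nu>1 - \<nu>2\<bar>"
  note error = product_dist_product_op_le[OF metric(2,3) decomp psi samplings _
      operators(1,2) operators(3)[unfolded S] F _ order1 order2, folded C dpsi S]
  have fine: "has_approx_order d\<psi> {a..b} ?fine S F \<nu> C"
    unfolding has_approx_order_def
  proof (intro ballI, clarify)
    fix J \<tau> t assume J: "(J, \<tau>) \<in> \<T>" "mesh J \<tau> \<le> 1" and t: "t \<in> {a..b}"
    have "0 < mesh J \<tau>"
      using samplings_mesh_bounds(1) samplings J(1) by blast
    then have "mesh J \<tau> powr \<nu>1 \<le> mesh J \<tau> powr \<nu>" "mesh J \<tau> powr \<nu>2 \<le> mesh J \<tau> powr \<nu>"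
      unfolding \<nu> using J(2) by (intro powr_mono'; simp)+
    then show "d\<psi> (F t) (S J \<tau> (\<lambda>i\<in>J. F (\<tau> i)) t) \<le> C * mesh J \<tau> powr \<nu>"
      by (rule error[OF J(1) t])
  qed
  have all: "has_approx_order d\<psi> {a..b} \<T> S F \<nu> (C * ?E)"
    unfolding has_approx_order_def
  proof (intro ballI, clarify)
    fix J \<tau> t assume J: "(J, \<tau>) \<in> \<T>" and t: "t \<in> {a..b}"
    have h: "0 < mesh J \<tau>" "mesh J \<tau> \<le> b - a"
      using samplings_mesh_bounds samplings J by blast+
    have "mesh J \<tau> powr \<nu>1 \<le> ?E * mesh J \<tau> powr \<nu>" "mesh J \<tau> powr \<nu>2 \<le> ?E * mesh J \<tau> powr \<nu>"
      unfolding \<nu> by (rule powr_le_max_one_powr_mult[OF h]; linarith)+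
    then have "d\<psi> (F t) (S J \<tau> (\<lambda>i\<in>J. F (\<tau> i)) t) \<le> C * (?E * mesh J \<tau> powr \<nu>)"
      by (rule error[OF J t])
    then show "d\<psi> (F t) (S J \<tau> (\<lambda>i\<in>J. F (\<tau> i)) t) \<le> C * ?E * mesh J \<tau> powr \<nu>"
      by (simp only: mult.assoc)
  qed
  have sub: "?fine \<subseteq> samplings {a..b}" "approx_operator {a..b} ?fine M S"
    using samplings operators(3) unfolding approx_operator_def by auto
  show ?thesis
  proof (intro conjI allI impI)
    show "has_approx_order d\<psi> {a..b} ?fine S F \<nu> C" by (rule fine)
  next
    fix K assume K: "majorized_with K M d d\<psi>"
    show "has_approx_order d {a..b} ?fine S F \<nu> (K * C)"
      by (rule has_approx_order_majorized[OF fine K sub(2,1) F])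
    show "has_approx_order d {a..b} \<T> S F \<nu> (K * C * ?E)"
      using has_approx_order_majorized[OF all K operators(3) samplings F]
      by (simp only: mult.assoc)
  qed
qed

end
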